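(* If $G$ is a connected graph of order $n\geq 3$, then the Randić index $R(G)$ and the diameter $D(G)$ satisfy $$R(G)-D(G)\geq \sqrt{2}-\frac{n+1}{2}$$ and $$\frac{R(G)}{D(G)}\geq \frac{n-3+2\sqrt{2}}{2n-2},$$ and in each of these two inequalities equality holds if and only if $G\cong P_n$.
   Context: Graphs are finite and simple. The order of a graph is its number of vertices. For a graph $G=(V,E)$, $d_u$ denotes the degree of the vertex $u$ in $G$, and the Randić index of $G$ is $R(G)=\sum_{uv\in E}\frac{1}{\sqrt{d_ud_v}}$. $D(G)$ is the diameter of the connected graph $G$. $P_n$ is the path on $n$ vertices. *)

theory Defs
  imports
    "HOL-Library.Extended_Real"
    "Graph_Theory.Pair_Digraph"
    "Graph_Theory.Digraph_Component"
    "Graph_Theory.Digraph_Isomorphism"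
    "Graph_Theory.Shortest_Path"
begin

text \<open>
  Finite simple graphs are the \<^locale>\<open>pair_graph\<close>s of the library: finite, symmetric, loop-free
  relations on a finite vertex set. An undirected edge corresponds to the two arcs between its
  endpoints, so the degree of a vertex is its \<^const>\<open>out_degree\<close>.
\<close>

abbreviation degree :: "'a pair_pre_digraph \<Rightarrow> 'a \<Rightarrow> nat" where
  "degree G u \<equiv> out_degree (with_proj G) u"

definition edges :: "'a pair_pre_digraph \<Rightarrow> 'a set set" where
  "edges G = {{u, v} | u v. (u, v) \<in> parcs G}"

text \<open>
  Without loops every edge has exactly two elements, so the nested product over its elements is
  the product of the degrees of the two endpoints, and each edge is counted once.
\<close>

definition randic_index :: "'a pair_pre_digraph \<Rightarrow> real" where
  "randic_index G = (\<Sum>e\<in>edges G. 1 / sqrt (\<Prod>u\<in>e. real (degree G u)))"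

text \<open>
  With unit arc weights the library's shortest-path cost is the usual distance. All distances in
  a connected graph are finite; \<^const>\<open>real_of_ereal\<close> would map an infinite supremum to 0, so the
  definition is only meaningful for connected graphs.
\<close>

definition distance :: "'a pair_pre_digraph \<Rightarrow> 'a \<Rightarrow> 'a \<Rightarrow> ereal" where
  "distance G u v = wf_digraph.\<mu> (with_proj G) (\<lambda>_. 1) u v"

definition graph_diameter :: "'a pair_pre_digraph \<Rightarrow> real" where
  "graph_diameter G = real_of_ereal (SUP (u, v) \<in> pverts G \<times> pverts G. distance G u v)"

definition path_graph :: "nat \<Rightarrow> nat pair_pre_digraph" where
  "path_graph n = \<lparr>pverts = {..<n}, parcs = {(i, j). i < n \<and> j < n \<and> (j = Suc i \<or> i = Suc j)}\<rparr>"

abbreviation isomorphic :: "'a pair_pre_digraph \<Rightarrow> 'b pair_pre_digraph \<Rightarrow> bool" where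
  "isomorphic G H \<equiv> digraph_iso (with_proj G) (with_proj H)"

end

(*
  Since the diameter D is at most n - 1, everything follows from R >= D/2 + sqrt 2 - 1.

  Split 2 / sqrt (x y) = arc_share x y + arc_share y x so that the endpoint of smaller degree
  carries the whole loss (1 / sqrt x - 1 / sqrt y)^2; then 2 R is the sum over the vertices u of
  s(u), the sum of the shares of the arcs leaving u. Let L_0, ..., L_D be the distance layers from
  an end of a diametral pair, and let y_i, the hub, have the largest degree M_i in L_i. Then
  s(y_i) >= 1 - (1 - sqrt (M_i / P_i))^2, where P_i is the largest of M_(i-1), M_i, M_(i+1).
  So the D + 1 hubs contribute D + 1 minus the losses at the layers next to a hub of larger degree,
  and those losses are paid by the vertices that are not hubs: if P_i = M_k, let j maximise
  M_j / 4^|k-j|. All degrees near y_j are then comparable with M_j, so each of the at least M_j - 2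
  non-hub neighbours u of y_j has s(u) >= 1 / sqrt M_j, and charging them is affordable because the
  charges decay geometrically in |k-j|. Only the two end layers retain an unpaid loss
  3/2 - sqrt 2, which a path attains.
*)

theory Submission
  imports Defs
begin

section \<open>Shares of an edge\<close>

text \<open>If \<open>x \<ge> y\<close> the share is just \<open>1 / x\<close>, so a non-isolated
  vertex without neighbours of larger degree collects exactly 1.\<close>

definition arc_share :: "real \<Rightarrow> real \<Rightarrow> real" where
  "arc_share x y = 1 / x - (max 0 (1 / sqrt x - 1 / sqrt y))\<^sup>2"

text \<open>Expanding the square writes \<open>2 / sqrt (x * y)\<close> as
  \<open>1 / x + 1 / y\<close> minus the full loss, and at most one of the two truncated losses is
  nonzero.\<close>

lemma arc_share_add:
  assumes "x > 0" "y > 0"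
  shows "arc_share x y + arc_share y x = 2 / sqrt (x * y)"
proof -
  have "(1 / sqrt x - 1 / sqrt y)\<^sup>2 = 1 / x + 1 / y - 2 / sqrt (x * y)"
    using assms by (simp add: power2_diff real_sqrt_mult power_one_over)
  moreover have "(1 / sqrt y - 1 / sqrt x)\<^sup>2 = (1 / sqrt x - 1 / sqrt y)\<^sup>2"
    by (rule power2_commute)
  ultimately show ?thesis by (simp add: arc_share_def max_def)
qed

lemma arc_share_antimono:
  assumes "0 < y" "y \<le> z"
  shows "arc_share x z \<le> arc_share x y"
proof -
  have "1 / sqrt z \<le> 1 / sqrt y" using assms by (simp add: frac_le)
  then show ?thesis by (auto simp: arc_share_def intro!: power_mono)
qed

text \<open>Removing the truncation can only increase the loss. The result needs no comparison of
  \<open>x\<close> and \<open>y\<close>, which suits payers: their degree may lie on either side of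
  that of their hub.\<close>

lemma arc_share_ge:
  assumes "x > 0" "y > 0"
  shows "2 / sqrt (x * y) - 1 / y \<le> arc_share x y"
proof -
  have "(max 0 (1 / sqrt x - 1 / sqrt y))\<^sup>2 \<le> (1 / sqrt x - 1 / sqrt y)\<^sup>2"
    by (simp add: max_def)
  also have "\<dots> = 1 / x + 1 / y - 2 / sqrt (x * y)"
    using assms by (simp add: power2_diff real_sqrt_mult power_one_over)
  finally show ?thesis by (simp add: arc_share_def)
qed

lemma arc_share_eq:
  assumes "0 < x" "x \<le> y"
  shows "x * arc_share x y = 1 - (1 - sqrt x / sqrt y)\<^sup>2"
proof -
  have "1 / sqrt y \<le> 1 / sqrt x" using assms by (simp add: frac_le)
  then have "x * arc_share x y = 1 - x * (1 / sqrt x - 1 / sqrt y)\<^sup>2"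
    using assms by (simp add: arc_share_def max_def right_diff_distrib)
  also have "x * (1 / sqrt x - 1 / sqrt y)\<^sup>2 = (sqrt x * (1 / sqrt x - 1 / sqrt y))\<^sup>2"
    using assms by (simp add: power_mult_distrib)
  also have "sqrt x * (1 / sqrt x - 1 / sqrt y) = 1 - sqrt x / sqrt y"
    using assms by (simp add: right_diff_distrib)
  finally show ?thesis .
qed

lemma arc_share_nonneg:
  assumes "x > 0" "y > 0"
  shows "0 \<le> arc_share x y"
proof -
  have "(max 0 (1 / sqrt x - 1 / sqrt y))\<^sup>2 \<le> (1 / sqrt x)\<^sup>2"
    using assms by (intro power_mono) auto
  then show ?thesis using assms by (simp add: arc_share_def power_one_over)
qed

section \<open>Numerical estimates for losses, payers and geometric weights\<close>

lemma sqrt2_bounds: "1414 / 1000 < sqrt (2 :: real)" "sqrt 2 < (1415 / 1000 :: real)"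
proof -
  show "1414 / 1000 < sqrt (2 :: real)" by (rule real_less_rsqrt) (simp add: power2_eq_square)
  show "sqrt 2 < (1415 / 1000 :: real)" by (rule real_less_lsqrt) (simp_all add: power2_eq_square)
qed

text \<open>With \<open>x = sqrt p\<close> the worst case is \<open>m = 2\<close>. Then both sides
  contain the factor \<open>x - sqrt 2\<close>, and a quadratic with negative discriminant
  remains.\<close>

lemma jump_loss_interior:
  assumes "2 \<le> m" "m \<le> p"
  shows "(1 - sqrt m / sqrt p)\<^sup>2 \<le> 1 / 8 * ((p - 2) / sqrt p)"
proof -
  define x where "x = sqrt p"
  have x: "x \<ge> sqrt 2" "x > 0" "p = x\<^sup>2" using assms by (auto simp: x_def)
  note c = sqrt2_bounds
  have "sqrt m \<le> x" "sqrt 2 \<le> sqrt m" using assms by (auto simp: x_def)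
  then have "(1 - sqrt m / x)\<^sup>2 \<le> (1 - sqrt 2 / x)\<^sup>2"
    using x(2) by (intro power_mono) (auto simp: divide_right_mono)
  also have "\<dots> \<le> 1 / 8 * ((x\<^sup>2 - 2) / x)"
  proof -
    \<comment> \<open>Completing the square in \<open>x^2 - (8 - sqrt 2) * x + 8 * sqrt 2\<close>:
      the centre is half of 8 - 1.414.\<close>
    have "0 \<le> (x - 3293 / 1000)\<^sup>2" by simp
    also have "\<dots> \<le> x * (x + sqrt 2) - 8 * (x - sqrt 2)"
    proof -
      have "x * (sqrt 2 - 1414 / 1000) \<ge> 0" using x c by simp
      then show ?thesis using c by (simp add: power2_eq_square algebra_simps)
    qed
    finally have "8 * (x - sqrt 2) * (x - sqrt 2) \<le> x * (x + sqrt 2) * (x - sqrt 2)"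
      using x by (intro mult_right_mono) auto
    also have "\<dots> = x * (x\<^sup>2 - 2)"
      by (simp add: algebra_simps power2_eq_square)
    finally have "8 * (x - sqrt 2)\<^sup>2 \<le> x * (x\<^sup>2 - 2)"
      by (simp only: power2_eq_square mult.assoc)
    then have "(x - sqrt 2)\<^sup>2 / x\<^sup>2 \<le> (x * (x\<^sup>2 - 2) / 8) / x\<^sup>2"
      by (intro divide_right_mono) auto
    moreover have "(x * (x\<^sup>2 - 2) / 8) / x\<^sup>2 = 1 / 8 * ((x\<^sup>2 - 2) / x)"
      using x(2) by (simp add: power2_eq_square)
    moreover have "1 - sqrt 2 / x = (x - sqrt 2) / x" using x(2) by (simp add: diff_divide_distrib)
    ultimately show ?thesis by (simp only: power_divide)
  qed
  finally show ?thesis by (simp only: x(3) real_sqrt_abs abs_of_pos x(2))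
qed

text \<open>The constant is \<open>(1 - 1 / sqrt 2)^2\<close>, the loss at an end of a path; the
  bound is sharp at \<open>m = 1\<close>, \<open>p = 2\<close>.\<close>

lemma jump_loss_end:
  assumes "1 \<le> m" "m \<le> p" "2 \<le> p"
  shows "(1 - sqrt m / sqrt p)\<^sup>2 \<le> (3 / 2 - sqrt 2) + 1 / 6 * ((p - 2) / sqrt p)"
proof -
  define x where "x = sqrt p"
  have x: "x \<ge> sqrt 2" "x > 0" "p = x\<^sup>2" using assms by (auto simp: x_def)
  note c = sqrt2_bounds
  have "sqrt m \<le> x" "1 \<le> sqrt m" using assms by (auto simp: x_def)
  then have "(1 - sqrt m / x)\<^sup>2 \<le> (1 - 1 / x)\<^sup>2"
    using x(2) by (intro power_mono) (auto simp: divide_right_mono)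
  also have "\<dots> \<le> (3 / 2 - sqrt 2) + 1 / 6 * ((x\<^sup>2 - 2) / x)"
  proof -
    \<comment> \<open>The cubic to be shown nonnegative vanishes at \<open>sqrt 2\<close>; this is
      its cofactor. The number 4.075 is the upper bound 5 * 1.415 - 3 of its linear
      coefficient.\<close>
    have "0 \<le> x\<^sup>2 - (5 * sqrt 2 - 3) * x + 3 * sqrt 2"
    proof -
      have "(5 * sqrt 2 - 3) * x \<le> 4075/1000 * x" using c x by (intro mult_right_mono) auto
      moreover have "0 \<le> (x - 4075/2000)\<^sup>2" by simp
      ultimately show ?thesis using c by (simp add: power2_diff power_divide)
    qed
    then have "0 \<le> (x - sqrt 2) * (x\<^sup>2 - (5 * sqrt 2 - 3) * x + 3 * sqrt 2)"
      using x by simp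
    also have "\<dots> = x * (x\<^sup>2 - 2) + 6 * x\<^sup>2 * (3/2 - sqrt 2) - 6 * (x - 1)\<^sup>2"
      by (simp add: algebra_simps power2_eq_square)
    finally have "6 * (x - 1)\<^sup>2 \<le> x * (x\<^sup>2 - 2) + 6 * x\<^sup>2 * (3/2 - sqrt 2)" by simp
    then have "(x - 1)\<^sup>2 / x\<^sup>2 \<le> (x\<^sup>2 * (3/2 - sqrt 2) + x * (x\<^sup>2 - 2) / 6) / x\<^sup>2"
      by (intro divide_right_mono) auto
    moreover have "(x\<^sup>2 * (3/2 - sqrt 2) + x * (x\<^sup>2 - 2) / 6) / x\<^sup>2
        = (3/2 - sqrt 2) + 1 / 6 * ((x\<^sup>2 - 2) / x)"
      using x(2) by (simp add: add_divide_distrib power2_eq_square)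
    moreover have "1 - 1 / x = (x - 1) / x" using x(2) by (simp add: diff_divide_distrib)
    ultimately show ?thesis by (simp only: power_divide)
  qed
  finally show ?thesis by (simp only: x(3) real_sqrt_abs abs_of_pos x(2))
qed

text \<open>For a vertex of degree \<open>d\<close> with one neighbour of degree \<open>m\<close> and the others of degree at most
  \<open>16 m\<close>, the right-hand side bounds the sum of its shares from below.\<close>

lemma inverse_sqrt_le_shares:
  assumes "1 \<le> d" "d \<le> 4 * m" "3 \<le> m"
  shows "1 / sqrt m
    \<le> (2 / sqrt (d * m) - 1 / m) + (d - 1) * (2 / sqrt (d * (16 * m)) - 1 / (16 * m))"
proof -
  define x e where "x = sqrt d" and "e = sqrt m"
  have x: "x \<ge> 1" "d = x\<^sup>2" and e: "e > 0" "m = e\<^sup>2"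
    using assms by (auto simp: x_def e_def)
  have e17: "e \<ge> 17 / 10" unfolding e_def using assms by (intro real_le_rsqrt) (simp add: power2_eq_square)
  have "x \<le> sqrt (4 * m)" unfolding x_def using assms by simp
  then have xe: "x \<le> 2 * e" by (simp add: real_sqrt_mult e_def)
  have pos: "x\<^sup>2 - 2 * x + 3 > 0" using zero_le_power2[of "x - 1"] by (simp add: power2_diff)
  \<comment> \<open>This is the claim multiplied by \<open>16 * x * e^2\<close>. Small
    \<open>x\<close> is settled by \<open>e \<ge> 17 / 10\<close>, large \<open>x\<close> by
    \<open>x \<le> 2 * e\<close>.\<close>
  have "x * (15 + x\<^sup>2) \<le> 8 * e * (x\<^sup>2 - 2 * x + 3)"
  proof (cases "x \<le> 3")
    case True
    have "x * (15 + x\<^sup>2) \<le> 8 * (17/10) * (x\<^sup>2 - 2 * x + 3)"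
    proof -
      have "0 \<le> (3 - x) * (x - 2)\<^sup>2" using True by simp
      \<comment> \<open>The point 131/66 minimises the quadratic left after subtracting
        \<open>(3 - x) * (x - 2)^2\<close>.\<close>
      moreover have "0 \<le> (x - 131/66)\<^sup>2" by simp
      ultimately show ?thesis by (simp add: power2_eq_square algebra_simps)
    qed
    also have "\<dots> \<le> 8 * e * (x\<^sup>2 - 2 * x + 3)"
      using e17 pos by (intro mult_right_mono) auto
    finally show ?thesis .
  next
    case False
    have "0 \<le> (3 * x + 1) * (x - 3)" using False by simp
    then have "15 + x\<^sup>2 \<le> 4 * (x\<^sup>2 - 2 * x + 3)" by (simp add: power2_eq_square algebra_simps)
    then have "x * (15 + x\<^sup>2) \<le> x * (4 * (x\<^sup>2 - 2 * x + 3))" using x by (intro mult_left_mono) auto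
    also have "\<dots> = (4 * x) * (x\<^sup>2 - 2 * x + 3)" by simp
    also have "\<dots> \<le> 8 * e * (x\<^sup>2 - 2 * x + 3)"
      using xe pos by (intro mult_right_mono) auto
    finally show ?thesis .
  qed
  then have "0 \<le> (8 * e * (x\<^sup>2 - 2 * x + 3) - x * (15 + x\<^sup>2)) / (16 * x * e\<^sup>2)"
    using x e by simp
  also have "\<dots> = (2 / (x * e) - 1 / e\<^sup>2) + (x\<^sup>2 - 1) * (2 / (4 * x * e) - 1 / (16 * e\<^sup>2)) - 1 / e"
    using x e by (simp add: field_simps power2_eq_square)
  finally have "1 / e \<le> (2 / (x * e) - 1 / m) + (d - 1) * (2 / (4 * x * e) - 1 / (16 * m))"
    by (simp add: x(2) e(2))
  moreover have "sqrt (d * m) = x * e" "sqrt (d * (16 * m)) = 4 * x * e" "sqrt m = e"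
    by (simp_all add: x_def e_def real_sqrt_mult)
  ultimately show ?thesis by (simp only:)
qed

text \<open>The excess equals \<open>sqrt p - 2 / sqrt p\<close>, so multiplying the degree by 4 at
  least doubles it. This turns dominance of degrees into geometrically decaying charges.\<close>

lemma scaled_excess_le:
  assumes "2 \<le> p" "p * 4 ^ t \<le> m"
  shows "(p - 2) / sqrt p \<le> (1 / 2) ^ t * ((m - 2) / sqrt m)"
proof -
  have mono: "sqrt a - 2 / sqrt a \<le> sqrt b - 2 / sqrt b" if "0 < a" "a \<le> b" for a b :: real
  proof -
    have "2 / sqrt b \<le> 2 / sqrt a" using that by (simp add: frac_le)
    moreover have "sqrt a \<le> sqrt b" using that by simp
    ultimately show ?thesis by linarith
  qed
  have eq: "(a - 2) / sqrt a = sqrt a - 2 / sqrt a" if "a > 0" for a :: real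
    using that by (simp add: diff_divide_distrib real_div_sqrt)
  have m: "m > 0" using assms by (intro less_le_trans[OF _ assms(2)] mult_pos_pos) auto
  have four: "sqrt (4 ^ t) = (2::real) ^ t"
    by (simp add: real_sqrt_power)
  have "(p - 2) / sqrt p = sqrt p - 2 / sqrt p" using assms by (intro eq) auto
  also have "\<dots> \<le> sqrt (m / 4 ^ t) - 2 / sqrt (m / 4 ^ t)"
    using assms by (intro mono) (auto simp: field_simps)
  also have "\<dots> = (1 / 2) ^ t * sqrt m - 2 ^ t * (2 / sqrt m)"
    by (simp add: real_sqrt_divide four power_one_over)
  also have "\<dots> \<le> (1 / 2) ^ t * sqrt m - (1 / 2) ^ t * (2 / sqrt m)"
    using m by (intro diff_mono mult_right_mono)
      (auto simp: power_one_over intro: order_trans[of _ 1])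
  also have "\<dots> = (1 / 2) ^ t * ((m - 2) / sqrt m)"
    using m by (simp add: eq right_diff_distrib)
  finally show ?thesis .
qed

text \<open>The exponents are 0, 0, 0, 1, 2, ...: two additional ones in front of a geometric series
  bounded by 2.\<close>

lemma sum_half_powers_le: "(\<Sum>q<n. (1 / 2 :: real) ^ (q - 2)) \<le> 4"
proof -
  have geo: "(\<Sum>q<k. (1 / 2 :: real) ^ q) = 2 - 2 * (1 / 2) ^ k" for k
    by (induction k) simp_all
  have "(\<Sum>q<n. (1 / 2 :: real) ^ (q - 2)) \<le> (\<Sum>q<Suc (Suc n). (1 / 2) ^ (q - 2))"
    by (intro sum_mono2) auto
  also have "\<dots> = 2 + (\<Sum>q<n. (1 / 2) ^ q)"
    by (simp add: sum.lessThan_Suc_shift del: sum.lessThan_Suc)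
  also have "\<dots> \<le> 4" unfolding geo by simp
  finally show ?thesis .
qed

section \<open>Degrees, walks and distances\<close>

text \<open>On both sides arcs are pairs with the projections as ends, so the vertex component of an
  isomorphism determines its arc component.\<close>

lemma isomorphic_path_graph_iff:
  assumes "pair_wf_digraph G"
  shows "isomorphic G (path_graph n) \<longleftrightarrow> (\<exists>h. bij_betw h (pverts G) {..<n} \<and>
    (\<forall>u\<in>pverts G. \<forall>v\<in>pverts G. (u, v) \<in> parcs G \<longleftrightarrow> h v = Suc (h u) \<or> h u = Suc (h v)))"
    (is "_ \<longleftrightarrow> (\<exists>h. ?P h)")
proof
  interpret pair_wf_digraph G by fact
  assume "isomorphic G (path_graph n)"
  then obtain f where f: "digraph_isomorphism f" and eq: "with_proj (path_graph n) = app_iso f (with_proj G)"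
    unfolding digraph_iso_def by blast
  let ?h = "iso_verts f"
  have "verts (with_proj (path_graph n)) = ?h ` pverts G"
    and arcs: "arcs (with_proj (path_graph n)) = iso_arcs f ` parcs G"
    and "tail (with_proj (path_graph n)) = iso_tail f"
    and "head (with_proj (path_graph n)) = iso_head f"
    unfolding eq by simp_all
  then have img: "?h ` pverts G = {..<n}" and ends: "iso_tail f = fst" "iso_head f = snd"
    by (simp_all add: path_graph_def)
  have inj: "inj_on ?h (pverts G)" using f by (simp add: digraph_isomorphism_def)
  have iso_arc: "iso_arcs f e = (?h (fst e), ?h (snd e))" if "e \<in> parcs G" for e
    using f that ends by (auto simp: digraph_isomorphism_def prod_eq_iff)
  have "(u, v) \<in> parcs G \<longleftrightarrow> (?h u, ?h v) \<in> parcs (path_graph n)"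
    if "u \<in> pverts G" "v \<in> pverts G" for u v
  proof
    assume "(u, v) \<in> parcs G"
    with iso_arc arcs show "(?h u, ?h v) \<in> parcs (path_graph n)" by force
  next
    assume "(?h u, ?h v) \<in> parcs (path_graph n)"
    then obtain e where e: "e \<in> parcs G" "(?h u, ?h v) = iso_arcs f e" using arcs by auto
    then have "fst e = u" "snd e = v"
      using iso_arc that inj arc_fst_in_verts arc_snd_in_verts by (auto dest: inj_onD)
    with e show "(u, v) \<in> parcs G" by auto
  qed
  then have "?P ?h"
    using inj img by (auto simp: bij_betw_def path_graph_def)
  then show "\<exists>h. ?P h" by blast
next
  interpret pair_wf_digraph G by fact
  assume "\<exists>h. ?P h"
  then obtain h where h: "?P h" ..
  define f where "f = \<lparr>iso_verts = h, iso_arcs = map_prod h h, iso_head = snd, iso_tail = fst\<rparr>"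
  have inj: "inj_on h (pverts G)" and img: "h ` pverts G = {..<n}"
    using h by (auto simp: bij_betw_def)
  have "inj_on (map_prod h h) (parcs G)"
    by (rule inj_on_subset[OF map_prod_inj_on[OF inj inj]]) (auto dest: in_arcsD1 in_arcsD2)
  then have "digraph_isomorphism f"
    using inj wf_digraph by (auto simp: digraph_isomorphism_def f_def)
  moreover have "map_prod h h ` parcs G = parcs (path_graph n)"
  proof (intro equalityI subsetI)
    fix a assume "a \<in> map_prod h h ` parcs G"
    then obtain u v where "(u, v) \<in> parcs G" and a: "a = (h u, h v)" by auto
    moreover from this have "u \<in> pverts G" "v \<in> pverts G" by (auto dest: in_arcsD1 in_arcsD2)
    moreover from this have "h u < n" "h v < n" using img by auto
    ultimately show "a \<in> parcs (path_graph n)"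
      using h by (simp add: path_graph_def)
  next
    fix b assume "b \<in> parcs (path_graph n)"
    then obtain i j where b: "b = (i, j)" and ij: "(i, j) \<in> parcs (path_graph n)" by (cases b) auto
    then have "i \<in> h ` pverts G" "j \<in> h ` pverts G" unfolding img by (auto simp: path_graph_def)
    then obtain u v where "u \<in> pverts G" "v \<in> pverts G" "i = h u" "j = h v" by blast
    moreover from this have "(u, v) \<in> parcs G" using h ij by (auto simp: path_graph_def)
    ultimately show "b \<in> map_prod h h ` parcs G" unfolding b by force
  qed
  then have "with_proj (path_graph n) = app_iso f (with_proj G)"
    using img by (simp add: app_iso_def f_def with_proj_def path_graph_def)
  ultimately show "isomorphic G (path_graph n)" unfolding digraph_iso_def by blast
qed

context pair_graph
begin

lemma degree_eq_card: "degree G u = card {v. (u, v) \<in> parcs G}"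
proof -
  have "{e \<in> parcs G. fst e = u} = Pair u ` {v. (u, v) \<in> parcs G}" by force
  then show ?thesis by (simp add: out_degree_def out_arcs_def card_image inj_on_def)
qed

lemma finite_neighbours: "finite {v. (u, v) \<in> parcs G}"
  by (rule finite_subset[OF _ pair_finite_verts]) (auto dest: in_arcsD2)

lemma degree_pos: "(u, v) \<in> parcs G \<Longrightarrow> degree G u > 0"
  unfolding degree_eq_card using finite_neighbours[of u] by (auto simp: card_gt_0_iff)

lemma degree_pos_head: "(u, v) \<in> parcs G \<Longrightarrow> degree G v > 0"
  using arcs_symmetric degree_pos by blast

lemma finite_edges: "finite (edges G)"
proof -
  have "edges G = (\<lambda>(u, v). {u, v}) ` parcs G" by (auto simp: edges_def)
  then show ?thesis using pair_finite_arcs by simp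
qed

section \<open>Walks and distances as natural numbers\<close>

lemma awalk_snoc:
  assumes "awalk u p v" and "(v, w) \<in> parcs G"
  shows "awalk u (p @ [(v, w)]) w"
  using assms in_arcsD2[OF assms(2)] by (intro awalk_appendI[OF assms(1)]) (simp add: awalk_simps)

lemma awalk_butlast:
  assumes "awalk u p v" and "p \<noteq> []"
  obtains w where "awalk u (butlast p) w" and "(w, v) \<in> parcs G"
proof -
  obtain q e where p: "p = q @ [e]" using \<open>p \<noteq> []\<close> by (cases p rule: rev_cases) auto
  have "awalk u q (fst e)" "e \<in> parcs G" "snd e = v"
    using assms(1) unfolding p by (auto simp: awalk_simps)
  then show thesis using that p by (cases e) simp
qed

text \<open>Yields lower bounds on distances; it is applied to the numbering of the vertices of a
  path.\<close>

lemma awalk_lipschitz: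
  fixes h :: "'a \<Rightarrow> nat"
  assumes "\<And>u v. (u, v) \<in> parcs G \<Longrightarrow> h v \<le> Suc (h u)" and "awalk u p v"
  shows "h v \<le> h u + length p"
  using assms(2)
proof (induction p arbitrary: u)
  case (Cons e p)
  then have "h v \<le> h (snd e) + length p" "(u, snd e) \<in> parcs G"
    by (auto simp: awalk_Cons_iff)
  then show ?case using assms(1)[of u "snd e"] by simp
qed (simp add: awalk_Nil_iff)

lemma awalk_cost_one: "awalk_cost (\<lambda>_. 1) p = real (length p)"
  by (induction p) simp_all

text \<open>The value is unspecified if no walk exists, so it is used only for vertices known to be
  joined by one.\<close>

definition hops :: "'a \<Rightarrow> 'a \<Rightarrow> nat" where
  "hops u v = (LEAST k. \<exists>p. awalk u p v \<and> length p = k)"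

lemma hops_le: "awalk u p v \<Longrightarrow> hops u v \<le> length p"
  unfolding hops_def by (rule Least_le) blast

lemma hops_witness:
  assumes "awalk u p v"
  obtains q where "awalk u q v" and "length q = hops u v"
proof -
  have "\<exists>q. awalk u q v \<and> length q = hops u v"
    unfolding hops_def by (rule LeastI_ex) (use assms in blast)
  then show thesis using that by blast
qed

lemma distance_eq_hops:
  assumes "awalk u p v"
  shows "distance G u v = ereal (real (hops u v))"
proof -
  obtain q where q: "awalk u q v" "length q = hops u v" using hops_witness[OF assms] .
  show ?thesis
    unfolding distance_def \<mu>_def
  proof (rule INF_eqI)
    fix p assume "p \<in> {p. awalk u p v}"
    then show "ereal (real (hops u v)) \<le> ereal (awalk_cost (\<lambda>_. 1) p)"
      by (simp add: awalk_cost_one hops_le)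
  next
    fix y assume "\<And>i. i \<in> {p. awalk u p v} \<Longrightarrow> y \<le> ereal (awalk_cost (\<lambda>_. 1) i)"
    from this[of q] show "y \<le> ereal (real (hops u v))" using q by (simp add: awalk_cost_one)
  qed
qed

text \<open>Connectedness is defined through the symmetric closure, whose reachability agrees with
  that of \<open>G\<close> because the arcs are symmetric.\<close>

lemma connected_awalk:
  assumes "connected (with_proj G)" "u \<in> pverts G" "v \<in> pverts G"
  obtains p where "awalk u p v"
proof -
  have "u \<rightarrow>\<^sup>*\<^bsub>with_proj (mk_symmetric (with_proj G))\<^esub> v"
    using assms by (auto simp: connected_def)
  then have "u \<rightarrow>\<^sup>*\<^bsub>with_proj G\<^esub> v"
    using reachable_mk_symmetric_eq[of u v] sym_arcs by simp
  then show thesis using that reachable_awalk by blast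
qed

text \<open>The supremum ranges over a finite nonempty set of finite distances, so it is a maximum
  and converting it to a real loses nothing.\<close>

lemma graph_diameter_attained:
  assumes "connected (with_proj G)"
  obtains x y where "x \<in> pverts G" "y \<in> pverts G" "graph_diameter G = real (hops x y)"
    "\<And>u v. u \<in> pverts G \<Longrightarrow> v \<in> pverts G \<Longrightarrow> hops u v \<le> hops x y"
proof -
  let ?V = "pverts G \<times> pverts G"
  have ne: "?V \<noteq> {}" using assms by (auto simp: connected_def strongly_connected_def)
  have fin: "finite ?V" by (simp add: pair_finite_verts)
  have "Max ((\<lambda>(u, v). hops u v) ` ?V) \<in> (\<lambda>(u, v). hops u v) ` ?V"
    using ne fin by (intro Max_in) auto
  then obtain x y where xy: "x \<in> pverts G" "y \<in> pverts G" "hops x y = Max ((\<lambda>(u, v). hops u v) ` ?V)"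
    by auto
  have max: "hops u v \<le> hops x y" if "u \<in> pverts G" "v \<in> pverts G" for u v
    unfolding xy(3) using fin that by (intro Max_ge) auto
  have dist: "distance G u v = ereal (real (hops u v))" if "u \<in> pverts G" "v \<in> pverts G" for u v
    using connected_awalk[OF assms that] distance_eq_hops by metis
  have "(SUP (u, v) \<in> ?V. distance G u v) = ereal (real (hops x y))"
  proof (rule antisym)
    show "(SUP (u, v) \<in> ?V. distance G u v) \<le> ereal (real (hops x y))"
      by (rule SUP_least) (auto simp: dist max)
    show "ereal (real (hops x y)) \<le> (SUP (u, v) \<in> ?V. distance G u v)"
      by (rule SUP_upper2[of "(x, y)"]) (auto simp: xy dist)
  qed
  then have "graph_diameter G = real (hops x y)" by (simp add: graph_diameter_def)
  then show thesis using that xy max by blast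
qed

end

section \<open>Shares of vertices\<close>

context pair_graph
begin

abbreviation deg :: "'a \<Rightarrow> real" where
  "deg u \<equiv> real (degree G u)"

definition vertex_share :: "'a \<Rightarrow> real" where
  "vertex_share u = (\<Sum>v | (u, v) \<in> parcs G. arc_share (deg u) (deg v))"

lemma sum_vertices_neighbours:
  "(\<Sum>u\<in>pverts G. \<Sum>v | (u, v) \<in> parcs G. f u v) = (\<Sum>(u, v)\<in>parcs G. f u v)"
proof -
  have "parcs G = (SIGMA u:pverts G. {v. (u, v) \<in> parcs G})"
    by (auto dest: in_arcsD1)
  then show ?thesis
    using sum.Sigma[of "pverts G" "\<lambda>u. {v. (u, v) \<in> parcs G}" f] pair_finite_verts finite_neighbours
    by simp
qed

lemma sum_arcs_swap: "(\<Sum>(u, v)\<in>parcs G. f u v) = (\<Sum>(u, v)\<in>parcs G. f v u)"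
proof -
  have "bij_betw prod.swap (parcs G) (parcs G)"
    by (rule bij_betwI[where g = prod.swap]) (auto intro: arcs_symmetric)
  from sum.reindex_bij_betw[OF this, of "\<lambda>(u, v). f u v"] show ?thesis
    by (simp add: case_prod_unfold)
qed

text \<open>The fibre of an edge under the map from arcs to edges has exactly two elements, as arcs
  come in opposite pairs and loops are excluded.\<close>

lemma sum_arcs_edges:
  fixes f :: "'a set \<Rightarrow> real"
  shows "(\<Sum>(u, v)\<in>parcs G. f {u, v}) = 2 * (\<Sum>e\<in>edges G. f e)"
proof -
  have "(\<lambda>a. {fst a, snd a}) ` parcs G \<subseteq> edges G" unfolding edges_def by force
  from sum.group[OF pair_finite_arcs finite_edges this]
  have "(\<Sum>(u, v)\<in>parcs G. f {u, v}) = (\<Sum>e\<in>edges G. \<Sum>(u, v)\<in>{a \<in> parcs G. {fst a, snd a} = e}. f {u, v})"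
    by (rule sym)
  also have "\<dots> = (\<Sum>e\<in>edges G. 2 * f e)"
  proof (rule sum.cong)
    fix e assume "e \<in> edges G"
    then obtain u v where uv: "e = {u, v}" "(u, v) \<in> parcs G" by (auto simp: edges_def)
    then have "{a \<in> parcs G. {fst a, snd a} = e} = {(u, v), (v, u)}"
      using arcs_symmetric by (auto simp: doubleton_eq_iff)
    then show "(\<Sum>(u, v)\<in>{a \<in> parcs G. {fst a, snd a} = e}. f {u, v}) = 2 * f e"
      using no_loops'[OF uv(2)] uv(1) by (simp add: insert_commute)
  qed simp
  finally show ?thesis by (simp add: sum_distrib_left)
qed

text \<open>Adding the share of each arc to that of its reversal doubles the total and gives
  \<open>4 * randic_index G\<close>, since each edge is met by two arcs.\<close>

lemma sum_vertex_share: "(\<Sum>u\<in>pverts G. vertex_share u) = 2 * randic_index G"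
proof -
  let ?s = "\<lambda>u v. arc_share (deg u) (deg v)"
  have "(\<Sum>(u, v)\<in>parcs G. ?s u v) + (\<Sum>(u, v)\<in>parcs G. ?s v u)
      = (\<Sum>(u, v)\<in>parcs G. ?s u v + ?s v u)"
    by (simp add: case_prod_unfold sum.distrib)
  also have "\<dots> = (\<Sum>(u, v)\<in>parcs G. 2 * (1 / sqrt (\<Prod>w\<in>{u, v}. deg w)))"
  proof (rule sum.cong)
    fix a assume "a \<in> parcs G"
    then obtain u v where a: "a = (u, v)" "(u, v) \<in> parcs G" by (cases a) auto
    then have "deg u > 0" "deg v > 0" using degree_pos arcs_symmetric by auto
    then show "(case a of (u, v) \<Rightarrow> ?s u v + ?s v u)
        = (case a of (u, v) \<Rightarrow> 2 * (1 / sqrt (\<Prod>w\<in>{u, v}. deg w)))"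
      using a no_loops'[OF a(2)] arc_share_add[of "deg u" "deg v"] by simp
  qed simp
  also have "\<dots> = 2 * (\<Sum>e\<in>edges G. 2 * (1 / sqrt (\<Prod>w\<in>e. deg w)))"
    by (rule sum_arcs_edges)
  also have "\<dots> = 4 * randic_index G" by (simp add: randic_index_def sum_distrib_left)
  finally have "(\<Sum>(u, v)\<in>parcs G. ?s u v) = 2 * randic_index G"
    using sum_arcs_swap[of ?s] by simp
  then show ?thesis by (simp add: vertex_share_def sum_vertices_neighbours)
qed

lemma vertex_share_nonneg: "0 \<le> vertex_share u"
  unfolding vertex_share_def
  using degree_pos degree_pos_head by (intro sum_nonneg arc_share_nonneg) auto

lemma vertex_share_ge_uniform:
  assumes "\<And>v. (u, v) \<in> parcs G \<Longrightarrow> deg v \<le> p"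
  shows "deg u * arc_share (deg u) p \<le> vertex_share u"
proof -
  have "(\<Sum>v | (u, v) \<in> parcs G. arc_share (deg u) p) \<le> vertex_share u"
    unfolding vertex_share_def using assms degree_pos_head
    by (intro sum_mono arc_share_antimono) auto
  then show ?thesis by (simp add: degree_eq_card)
qed

lemma vertex_share_ge_neighbour:
  assumes "(u, w) \<in> parcs G" and "\<And>v. (u, v) \<in> parcs G \<Longrightarrow> deg v \<le> p"
  shows "arc_share (deg u) (deg w) + (deg u - 1) * arc_share (deg u) p \<le> vertex_share u"
proof -
  let ?N = "{v. (u, v) \<in> parcs G}"
  have "w \<in> ?N" using assms by simp
  have "(\<Sum>v\<in>?N - {w}. arc_share (deg u) p) \<le> (\<Sum>v\<in>?N - {w}. arc_share (deg u) (deg v))"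
    using assms(2) degree_pos_head by (intro sum_mono arc_share_antimono) auto
  moreover have "real (card (?N - {w})) = deg u - 1"
    using \<open>w \<in> ?N\<close> degree_pos[OF assms(1)] finite_neighbours[of u]
    by (simp add: degree_eq_card card_Diff_singleton of_nat_diff)
  ultimately show ?thesis
    unfolding vertex_share_def using sum.remove[OF finite_neighbours \<open>w \<in> ?N\<close>, of "\<lambda>v. arc_share (deg u) (deg v)"]
    by simp
qed

text \<open>Here \<open>w\<close> is a dominant hub: degrees exceed its degree by at most a factor 4
  per layer. The vertex \<open>u\<close> lies within one layer of \<open>w\<close> and its
  neighbours within two, whence 4 and 16.\<close>

lemma vertex_share_ge_payer:
  assumes "(u, w) \<in> parcs G" and "3 \<le> deg w" and "deg u \<le> 4 * deg w"
    and "\<And>v. (u, v) \<in> parcs G \<Longrightarrow> deg v \<le> 16 * deg w"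
  shows "1 / sqrt (deg w) \<le> vertex_share u"
proof -
  let ?d = "deg u" and ?m = "deg w"
  have d: "?d \<ge> 1" using degree_pos[OF assms(1)] by simp
  have "1 / sqrt ?m \<le> (2 / sqrt (?d * ?m) - 1 / ?m)
      + (?d - 1) * (2 / sqrt (?d * (16 * ?m)) - 1 / (16 * ?m))"
    by (rule inverse_sqrt_le_shares) (use assms d in auto)
  also have "\<dots> \<le> arc_share ?d ?m + (?d - 1) * arc_share ?d (16 * ?m)"
    using d assms(2) by (intro add_mono mult_left_mono arc_share_ge) auto
  also have "\<dots> \<le> vertex_share u" by (rule vertex_share_ge_neighbour) (use assms in auto)
  finally show ?thesis .
qed

end

lemma ex_max_image:
  fixes f :: "'b \<Rightarrow> 'c :: linorder"
  assumes "finite A" "A \<noteq> {}"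
  obtains x where "x \<in> A" "\<And>y. y \<in> A \<Longrightarrow> f y \<le> f x"
proof -
  have "Max (f ` A) \<in> f ` A" using assms by (intro Max_in) auto
  then obtain x where "x \<in> A" "f x = Max (f ` A)" by auto
  then show thesis using that assms by simp
qed

text \<open>Subtraction of naturals is truncated, so one summand vanishes and the sum is the
  absolute difference.\<close>

abbreviation gap :: "nat \<Rightarrow> nat \<Rightarrow> nat" where
  "gap i j \<equiv> (i - j) + (j - i)"

text \<open>The exponent \<open>gap i a - 2\<close> is truncated, so the layers within distance 2 of \<open>a\<close> have
  weight 1.\<close>

lemma sum_gap_weights_le:
  assumes "a \<le> D"
  shows "(\<Sum>i\<le>D. (1 / 2 :: real) ^ (gap i a - 2)) \<le> 7"
proof -
  let ?f = "\<lambda>q. (1 / 2 :: real) ^ (q - 2)"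
  have "(\<Sum>i<a. ?f (gap i a)) = (\<Sum>i<a. ?f (Suc (a - Suc i)))"
    by (rule sum.cong) auto
  also have "\<dots> = (\<Sum>q<a. ?f (Suc q))"
    by (rule sum.nat_diff_reindex)
  \<comment> \<open>Layer \<open>a\<close> itself is counted in the right half, so this half is at
    most 4 - 1 and the total at most 3 + 4.\<close>
  also have "\<dots> = (\<Sum>q<Suc a. ?f q) - 1"
    by (simp add: sum.lessThan_Suc_shift del: sum.lessThan_Suc)
  finally have left: "(\<Sum>i<a. ?f (gap i a)) \<le> 3" using sum_half_powers_le[of "Suc a"] by simp
  have "(\<Sum>i\<in>{a..D}. ?f (gap i a)) = (\<Sum>q<Suc (D - a). ?f q)"
    by (rule sum.reindex_bij_witness[of _ "\<lambda>q. q + a" "\<lambda>i. i - a"]) (use assms in auto)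
  then have right: "(\<Sum>i\<in>{a..D}. ?f (gap i a)) \<le> 4" using sum_half_powers_le[of "Suc (D - a)"] by simp
  have "{..D} = {..<a} \<union> {a..D}" using assms by auto
  then have "(\<Sum>i\<le>D. ?f (gap i a)) = (\<Sum>i<a. ?f (gap i a)) + (\<Sum>i\<in>{a..D}. ?f (gap i a))"
    by (simp only:) (rule sum.union_disjoint; auto)
  then show ?thesis using left right by simp
qed

section \<open>Distance layers\<close>

text \<open>Captures what is used of the distances \<open>\<delta>\<close> from one end of a
  diametral pair, with \<open>D\<close> the largest of them.\<close>

locale layered_graph = pair_graph G for G :: "'a pair_pre_digraph" +
  fixes \<delta> :: "'a \<Rightarrow> nat" and D :: nat
  assumes level_Suc: "(u, v) \<in> parcs G \<Longrightarrow> \<delta> v \<le> Suc (\<delta> u)"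
    and parent_ex: "v \<in> pverts G \<Longrightarrow> \<delta> v > 0 \<Longrightarrow> \<exists>u. (u, v) \<in> parcs G \<and> \<delta> v = Suc (\<delta> u)"
    and level_le: "v \<in> pverts G \<Longrightarrow> \<delta> v \<le> D"
    and level_attained: "\<exists>v\<in>pverts G. \<delta> v = D"
begin

definition layer :: "nat \<Rightarrow> 'a set" where
  "layer i = {v \<in> pverts G. \<delta> v = i}"

lemma finite_layer: "finite (layer i)"
  by (simp add: layer_def pair_finite_verts)

text \<open>Descends from layer \<open>D\<close> by taking parents.\<close>

lemma layer_nonempty: "i \<le> D \<Longrightarrow> layer i \<noteq> {}"
proof (induction i rule: inc_induct)
  case base
  then show ?case using level_attained by (auto simp: layer_def)
next
  case (step i)
  then obtain v where "v \<in> pverts G" "\<delta> v = Suc i" by (auto simp: layer_def)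
  then obtain u where "(u, v) \<in> parcs G" "\<delta> u = i" using parent_ex[of v] by auto
  then show ?case using in_arcsD1 by (auto simp: layer_def)
qed

lemma levels_le_card: "D + 1 \<le> card (pverts G)"
proof -
  have "{..D} \<subseteq> \<delta> ` pverts G" using layer_nonempty by (fastforce simp: layer_def)
  then have "card {..D} \<le> card (\<delta> ` pverts G)" using pair_finite_verts by (intro card_mono) auto
  also have "\<dots> \<le> card (pverts G)" by (rule card_image_le[OF pair_finite_verts])
  finally show ?thesis by simp
qed

definition hub :: "nat \<Rightarrow> 'a" where
  "hub i = (SOME v. v \<in> layer i \<and> (\<forall>w\<in>layer i. deg w \<le> deg v))"

lemma hub:
  assumes "i \<le> D"
  shows "hub i \<in> pverts G" "\<delta> (hub i) = i"
    and "\<And>w. w \<in> pverts G \<Longrightarrow> \<delta> w = i \<Longrightarrow> deg w \<le> deg (hub i)"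
proof -
  obtain v where "v \<in> layer i" "\<And>w. w \<in> layer i \<Longrightarrow> deg w \<le> deg v"
    using ex_max_image[OF finite_layer layer_nonempty[OF assms], of deg] by blast
  then have "\<exists>v. v \<in> layer i \<and> (\<forall>w\<in>layer i. deg w \<le> deg v)" by blast
  then have "hub i \<in> layer i \<and> (\<forall>w\<in>layer i. deg w \<le> deg (hub i))"
    unfolding hub_def by (rule someI_ex)
  then show "hub i \<in> pverts G" "\<delta> (hub i) = i"
    and "\<And>w. w \<in> pverts G \<Longrightarrow> \<delta> w = i \<Longrightarrow> deg w \<le> deg (hub i)"
    by (auto simp: layer_def)
qed

lemma arc_levels:
  assumes "(u, v) \<in> parcs G"
  shows "gap (\<delta> u) (\<delta> v) \<le> 1"
  using level_Suc[OF assms] level_Suc[OF arcs_symmetric[OF assms]] by linarith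

lemma deg_le_hub: "v \<in> pverts G \<Longrightarrow> deg v \<le> deg (hub (\<delta> v))"
  using hub(3)[OF level_le] by simp

text \<open>This is \<open>P_i\<close>. Arcs join equal or consecutive layers, so it bounds the
  degrees of all neighbours of vertices in layer \<open>i\<close>.\<close>

definition window_max :: "nat \<Rightarrow> real" where
  "window_max i = Max ((\<lambda>j. deg (hub j)) ` {j. j \<le> D \<and> gap i j \<le> 1})"

lemma finite_window: "finite {j. j \<le> D \<and> gap i j \<le> 1}"
  by (rule finite_subset[of _ "{..D}"]) auto

lemma window_max_ge: "j \<le> D \<Longrightarrow> gap i j \<le> 1 \<Longrightarrow> deg (hub j) \<le> window_max i"
  unfolding window_max_def using finite_window by (intro Max_ge) auto

lemma window_max_attained:
  assumes "i \<le> D"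
  obtains j where "j \<le> D" "gap i j \<le> 1" "window_max i = deg (hub j)"
proof -
  have "i \<in> {j. j \<le> D \<and> gap i j \<le> 1}" using assms by simp
  then have "window_max i \<in> (\<lambda>j. deg (hub j)) ` {j. j \<le> D \<and> gap i j \<le> 1}"
    unfolding window_max_def using finite_window by (intro Max_in) auto
  then show thesis using that by auto
qed

text \<open>By \<open>arc_share_eq\<close>, the amount by which the total share of
  \<open>hub i\<close> could fall below 1 if all its neighbours had degree
  \<open>window_max i\<close>.\<close>

definition jump_loss :: "nat \<Rightarrow> real" where
  "jump_loss i = (1 - sqrt (deg (hub i)) / sqrt (window_max i))\<^sup>2"

lemma hub_deg_pos:
  assumes "D \<ge> 1" "i \<le> D"
  shows "deg (hub i) \<ge> 1"
proof (cases "i = 0")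
  case True
  obtain v where "v \<in> pverts G" "\<delta> v = 1" using layer_nonempty[of 1] assms by (auto simp: layer_def)
  then obtain u where u: "(u, v) \<in> parcs G" "\<delta> u = 0" using parent_ex[of v] by auto
  then have "deg u \<ge> 1" using degree_pos by fastforce
  also have "deg u \<le> deg (hub 0)" using u deg_le_hub[of u] in_arcsD1 by auto
  finally show ?thesis using True by simp
next
  case False
  obtain u where "(u, hub i) \<in> parcs G" using parent_ex[of "hub i"] hub[OF assms(2)] False by auto
  then show ?thesis using degree_pos[OF arcs_symmetric] by fastforce
qed

text \<open>The hub need not have a child itself. Some vertex of its layer has both a child and a
  parent, and the hub has at least the degree of that vertex.\<close>

lemma hub_deg_interior:
  assumes "0 < i" "i < D"
  shows "deg (hub i) \<ge> 2"
proof -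
  obtain v where v: "v \<in> pverts G" "\<delta> v = Suc i"
    using layer_nonempty[of "Suc i"] assms by (auto simp: layer_def)
  then obtain u where u: "(u, v) \<in> parcs G" "\<delta> u = i" using parent_ex[of v] by auto
  then have "u \<in> pverts G" using in_arcsD1 by blast
  then obtain w where w: "(w, u) \<in> parcs G" "\<delta> u = Suc (\<delta> w)" using parent_ex[of u] u assms by auto
  have "card {v, w} \<le> card {v. (u, v) \<in> parcs G}"
    using u w arcs_symmetric finite_neighbours by (intro card_mono) auto
  moreover have "v \<noteq> w" using v u w by auto
  ultimately have "deg u \<ge> 2" by (simp add: degree_eq_card)
  then show ?thesis using deg_le_hub[OF \<open>u \<in> pverts G\<close>] u by simp
qed

lemma hub_share:
  assumes "D \<ge> 1" "i \<le> D"
  shows "1 - jump_loss i \<le> vertex_share (hub i)"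
proof -
  have "deg v \<le> window_max i" if "(hub i, v) \<in> parcs G" for v
  proof -
    have "v \<in> pverts G" using that in_arcsD2 by blast
    then have "deg v \<le> deg (hub (\<delta> v))" "\<delta> v \<le> D" using deg_le_hub level_le by auto
    then show ?thesis using window_max_ge[of "\<delta> v" i] arc_levels[OF that] hub[OF assms(2)] by simp
  qed
  then have "deg (hub i) * arc_share (deg (hub i)) (window_max i) \<le> vertex_share (hub i)"
    by (rule vertex_share_ge_uniform)
  moreover have "deg (hub i) \<le> window_max i" using window_max_ge[of i i] assms by simp
  ultimately show ?thesis
    using arc_share_eq[of "deg (hub i)" "window_max i"] hub_deg_pos[OF assms]
    by (simp add: jump_loss_def)
qed

section \<open>Charging the losses to the vertices that are not hubs\<close>

definition extra :: "'a set" where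
  "extra = pverts G - hub ` {..D}"

text \<open>Only the hubs of the two adjacent layers can be neighbours of \<open>hub i\<close> among
  all hubs. Every other neighbour is a payer, and \<open>dominating\<close> supplies the degree
  bounds for it.\<close>

lemma hub_excess_le:
  assumes "D \<ge> 1" "i \<le> D" "3 \<le> deg (hub i)"
    and dominating: "\<And>k. k \<le> D \<Longrightarrow> deg (hub k) \<le> 4 ^ gap i k * deg (hub i)"
  shows "(deg (hub i) - 2) / sqrt (deg (hub i)) \<le> (\<Sum>u | u \<in> extra \<and> gap i (\<delta> u) \<le> 1. vertex_share u)"
proof -
  let ?y = "hub i"
  let ?N = "{v. (?y, v) \<in> parcs G}"
  let ?X = "?N \<inter> extra"
  have dom: "deg v \<le> 4 ^ gap i (\<delta> v) * deg ?y" if "v \<in> pverts G" for v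
    using deg_le_hub[OF that] dominating[OF level_le[OF that]] by linarith
  \<comment> \<open>For \<open>i = 0\<close> the truncated \<open>i - 1\<close> is 0, which merely
    adds \<open>hub 0\<close> to the right-hand side.\<close>
  have "?N - ?X \<subseteq> hub ` {i - 1, i + 1}"
  proof
    fix v assume v: "v \<in> ?N - ?X"
    then have "v \<in> pverts G" "(?y, v) \<in> parcs G" by (auto dest: in_arcsD2)
    with v obtain k where k: "k \<le> D" "v = hub k" by (auto simp: extra_def)
    have "gap i k \<le> 1" using arc_levels[OF \<open>(?y, v) \<in> parcs G\<close>] hub(2) k assms(2) by simp
    moreover have "k \<noteq> i" using k no_loops'[OF \<open>(?y, v) \<in> parcs G\<close>] by auto
    ultimately have "k = i - 1 \<or> k = i + 1" by linarith
    then show "v \<in> hub ` {i - 1, i + 1}" using k by auto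
  qed
  then have "card (?N - ?X) \<le> card (hub ` {i - 1, i + 1})" by (intro card_mono) auto
  also have "\<dots> \<le> 2" using card_image_le[of "{i - 1, i + 1}" hub] by simp
  finally have "card ?N - 2 \<le> card ?X"
    using card_Diff_subset_Int[of ?N ?X] finite_neighbours[of ?y] by (simp add: Int_absorb)
  then have "deg ?y - 2 \<le> real (card ?X)"
    by (simp add: degree_eq_card)
  then have "(deg ?y - 2) / sqrt (deg ?y) \<le> real (card ?X) * (1 / sqrt (deg ?y))"
    by (simp add: divide_right_mono)
  also have "\<dots> = (\<Sum>u\<in>?X. 1 / sqrt (deg ?y))" by simp
  also have "\<dots> \<le> (\<Sum>u\<in>?X. vertex_share u)"
  proof (rule sum_mono)
    fix u assume "u \<in> ?X"
    then have u: "(?y, u) \<in> parcs G" "u \<in> pverts G" by (auto dest: in_arcsD2)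
    have near: "gap i (\<delta> u) \<le> 1" using arc_levels[OF u(1)] hub[OF assms(2)] by simp
    show "1 / sqrt (deg ?y) \<le> vertex_share u"
    proof (rule vertex_share_ge_payer)
      show "(u, ?y) \<in> parcs G" by (rule arcs_symmetric[OF u(1)])
      have "4 ^ gap i (\<delta> u) * deg ?y \<le> 4 ^ 1 * deg ?y"
        using near by (intro mult_right_mono power_increasing) auto
      then show "deg u \<le> 4 * deg ?y" using dom[OF u(2)] by simp
    next
      fix v assume v: "(u, v) \<in> parcs G"
      then have "gap i (\<delta> v) \<le> 2" using near arc_levels[OF v] by linarith
      then have "4 ^ gap i (\<delta> v) * deg ?y \<le> 4 ^ 2 * deg ?y"
        by (intro mult_right_mono power_increasing) auto
      then show "deg v \<le> 16 * deg ?y" using dom[OF in_arcsD2[OF v]] by simp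
    qed (use assms in simp)
  qed
  also have "\<dots> \<le> (\<Sum>u | u \<in> extra \<and> gap i (\<delta> u) \<le> 1. vertex_share u)"
  proof (rule sum_mono2)
    show "?X \<subseteq> {u \<in> extra. gap i (\<delta> u) \<le> 1}"
      using arc_levels hub[OF assms(2)] by fastforce
  qed (auto simp: extra_def pair_finite_verts vertex_share_nonneg)
  finally show ?thesis .
qed

text \<open>The excess at layer \<open>k\<close> of the window is transferred to the dominant layer
  \<open>j\<close> at the cost of a factor \<open>(1 / 2) ^ gap k j\<close>, and is paid around
  \<open>j\<close>.\<close>

lemma window_excess_le:
  assumes "D \<ge> 1" "i \<le> D" "2 \<le> window_max i"
  shows "(window_max i - 2) / sqrt (window_max i)
    \<le> (\<Sum>u\<in>extra. (1 / 2) ^ (gap i (\<delta> u) - 2) * vertex_share u)"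
proof (cases "3 \<le> window_max i")
  case False
  obtain k where "window_max i = deg (hub k)" using window_max_attained[OF assms(2)] by metis
  \<comment> \<open>Degrees are integers, so the maximum is exactly 2 and the excess is
    zero.\<close>
  then have "window_max i = 2" using False assms(3) by (simp add: numeral_eq_Suc)
  then show ?thesis by (simp add: sum_nonneg vertex_share_nonneg)
next
  case True
  obtain k where k: "k \<le> D" "gap i k \<le> 1" "window_max i = deg (hub k)"
    using window_max_attained[OF assms(2)] .
  obtain j where j: "j \<le> D"
    and max: "\<And>l. l \<le> D \<Longrightarrow> deg (hub l) / 4 ^ gap k l \<le> deg (hub j) / 4 ^ gap k j"
    using ex_max_image[of "{..D}" "\<lambda>l. deg (hub l) / 4 ^ gap k l"] by auto
  have top: "deg (hub k) * 4 ^ gap k j \<le> deg (hub j)"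
    using max[OF k(1)] by (simp add: field_simps)
  have dom: "deg (hub l) \<le> 4 ^ gap j l * deg (hub j)" if "l \<le> D" for l
  proof -
    have "deg (hub l) \<le> deg (hub j) * (4 ^ gap k l / 4 ^ gap k j)"
      using max[OF that] by (simp add: field_simps)
    also have "\<dots> \<le> deg (hub j) * 4 ^ gap j l"
    proof (rule mult_left_mono)
      \<comment> \<open>Triangle inequality for \<open>gap\<close>.\<close>
      have "(4::real) ^ gap k l \<le> 4 ^ (gap j l + gap k j)"
        by (rule power_increasing) auto
      then show "(4::real) ^ gap k l / 4 ^ gap k j \<le> 4 ^ gap j l"
        by (simp add: power_add field_simps)
    qed simp
    finally show ?thesis by (simp add: mult.commute)
  qed
  have "deg (hub k) * 1 \<le> deg (hub k) * 4 ^ gap k j" by (intro mult_left_mono) auto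
  then have "3 \<le> deg (hub j)" using top True k(3) by linarith
  have "(window_max i - 2) / sqrt (window_max i)
      \<le> (1 / 2) ^ gap k j * ((deg (hub j) - 2) / sqrt (deg (hub j)))"
    using top k(3) assms(3) by (intro scaled_excess_le) auto
  also have "\<dots> \<le> (1 / 2) ^ gap k j * (\<Sum>u | u \<in> extra \<and> gap j (\<delta> u) \<le> 1. vertex_share u)"
    using hub_excess_le[OF assms(1) j \<open>3 \<le> deg (hub j)\<close> dom] by (intro mult_left_mono) auto
  also have "\<dots> = (\<Sum>u | u \<in> extra \<and> gap j (\<delta> u) \<le> 1. (1 / 2) ^ gap k j * vertex_share u)"
    by (rule sum_distrib_left)
  also have "\<dots> \<le> (\<Sum>u | u \<in> extra \<and> gap j (\<delta> u) \<le> 1. (1 / 2) ^ (gap i (\<delta> u) - 2) * vertex_share u)"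
  proof (intro sum_mono mult_right_mono vertex_share_nonneg power_decreasing)
    fix u assume "u \<in> {u. u \<in> extra \<and> gap j (\<delta> u) \<le> 1}"
    \<comment> \<open>Passing from \<open>i\<close> to \<open>k\<close> and from \<open>j\<close> to
      the layer of \<open>u\<close> costs at most one each, hence the truncation by 2 in the
      weights.\<close>
    then show "gap i (\<delta> u) - 2 \<le> gap k j" using k(2) by auto
  qed auto
  also have "\<dots> \<le> (\<Sum>u\<in>extra. (1 / 2) ^ (gap i (\<delta> u) - 2) * vertex_share u)"
    by (rule sum_mono2) (auto simp: extra_def pair_finite_verts vertex_share_nonneg)
  finally show ?thesis .
qed

text \<open>A hub attaining its window maximum loses nothing. Otherwise the numerical bounds apply,
  with the constant term only at the two ends, where the degree may be 1.\<close>

lemma jump_loss_le: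
  assumes "D \<ge> 1" "i \<le> D"
  shows "jump_loss i \<le> (if i = 0 \<or> i = D then 3 / 2 - sqrt 2 else 0)
    + (if i = 0 \<or> i = D then 1 / 6 else 1 / 8)
      * (\<Sum>u\<in>extra. (1 / 2) ^ (gap i (\<delta> u) - 2) * vertex_share u)"
    (is "_ \<le> ?a + ?b * ?S")
proof -
  have "?S \<ge> 0" by (intro sum_nonneg mult_nonneg_nonneg vertex_share_nonneg) auto
  then have nonneg: "0 \<le> ?a + ?b * ?S"
    using sqrt2_bounds by (intro add_nonneg_nonneg mult_nonneg_nonneg) auto
  have le: "deg (hub i) \<le> window_max i" using window_max_ge[of i i] assms by simp
  note pos = hub_deg_pos[OF assms]
  show ?thesis
  proof (cases "deg (hub i) = window_max i")
    case True
    then have "sqrt (deg (hub i)) / sqrt (window_max i) = 1" using pos by simp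
    then have "jump_loss i = 0" unfolding jump_loss_def by simp
    then show ?thesis using nonneg by (simp only:)
  next
    case False
    obtain k where k: "window_max i = deg (hub k)" using window_max_attained[OF assms(2)] by metis
    \<comment> \<open>Strictness between integers, the smaller at least 1, makes the larger at least
      2.\<close>
    have "degree G (hub i) < degree G (hub k)" using False le k by simp
    then have two: "2 \<le> window_max i" using pos k by simp
    have "jump_loss i \<le> ?a + ?b * ((window_max i - 2) / sqrt (window_max i))"
    proof (cases "i = 0 \<or> i = D")
      case True
      then have "?a = 3 / 2 - sqrt 2" "?b = 1 / 6" by auto
      then show ?thesis unfolding jump_loss_def using jump_loss_end[OF pos le two] by (simp only:)
    next
      case False
      then have "2 \<le> deg (hub i)" using hub_deg_interior assms by simp
      moreover have "?a = 0" "?b = 1 / 8" using False by auto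
      ultimately show ?thesis
        unfolding jump_loss_def using jump_loss_interior[OF _ le] by (simp only: add_0)
    qed
    also have "\<dots> \<le> ?a + ?b * ?S"
      by (intro add_left_mono mult_left_mono window_excess_le[OF assms two]) simp
    finally show ?thesis .
  qed
qed

text \<open>Exchanging the sums over layers and payers shows that no payer is charged more than its
  own share. What remains is \<open>2 * R \<ge> D + 1 - 2 * (3 / 2 - sqrt 2)\<close>; the two end
  layers are distinct as \<open>D \<ge> 1\<close>.\<close>

lemma randic_index_ge:
  assumes "D \<ge> 1"
  shows "real D / 2 + sqrt 2 - 1 \<le> randic_index G"
proof -
  let ?a = "\<lambda>i. if i = 0 \<or> i = D then 3 / 2 - sqrt 2 else 0"
  let ?b = "\<lambda>i. if i = 0 \<or> i = D then 1 / 6 else 1 / 8 :: real"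
  let ?\<omega> = "\<lambda>i u. (1 / 2 :: real) ^ (gap i (\<delta> u) - 2)"
  have fin: "finite extra" by (simp add: extra_def pair_finite_verts)
  have ends: "(\<Sum>i\<le>D. if i = 0 \<or> i = D then c else 0) = 2 * c" for c :: real
  proof -
    have "(\<Sum>i\<le>D. if i = 0 \<or> i = D then c else 0) = (\<Sum>i\<in>{0, D}. c)"
      by (rule sum.mono_neutral_cong_right) auto
    then show ?thesis using assms by simp
  qed
  have weight: "(\<Sum>i\<le>D. ?b i * ?\<omega> i u) \<le> 1" if "u \<in> extra" for u
  proof -
    have "\<delta> u \<le> D" using that level_le by (simp add: extra_def)
    have "(\<Sum>i\<le>D. ?b i * ?\<omega> i u) \<le> (\<Sum>i\<le>D. 1 / 8 * ?\<omega> i u + (if i = 0 \<or> i = D then 1 / 24 else 0))"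
    proof (rule sum_mono)
      fix i
      have "?\<omega> i u \<le> 1" by (rule power_le_one) auto
      then show "?b i * ?\<omega> i u \<le> 1 / 8 * ?\<omega> i u + (if i = 0 \<or> i = D then 1 / 24 else 0)" by simp
    qed
    also have "\<dots> = 1 / 8 * (\<Sum>i\<le>D. ?\<omega> i u) + 2 * (1 / 24)"
      by (simp only: sum.distrib ends sum_distrib_left)
    \<comment> \<open>The end layers exceed the rate 1/8 by 1/6 - 1/8 = 1/24 each, so the total is
      at most 7/8 + 2/24 = 23/24.\<close>
    also have "\<dots> \<le> 1" using sum_gap_weights_le[OF \<open>\<delta> u \<le> D\<close>] by simp
    finally show ?thesis .
  qed
  have "(\<Sum>i\<le>D. jump_loss i) \<le> (\<Sum>i\<le>D. ?a i + ?b i * (\<Sum>u\<in>extra. ?\<omega> i u * vertex_share u))"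
    by (rule sum_mono) (use jump_loss_le[OF assms] in auto)
  also have "\<dots> = 2 * (3 / 2 - sqrt 2) + (\<Sum>i\<le>D. \<Sum>u\<in>extra. ?b i * ?\<omega> i u * vertex_share u)"
    by (simp only: sum.distrib ends sum_distrib_left mult.assoc)
  also have "(\<Sum>i\<le>D. \<Sum>u\<in>extra. ?b i * ?\<omega> i u * vertex_share u)
      = (\<Sum>u\<in>extra. (\<Sum>i\<le>D. ?b i * ?\<omega> i u) * vertex_share u)"
    by (subst sum.swap) (simp only: sum_distrib_right)
  also have "\<dots> \<le> (\<Sum>u\<in>extra. 1 * vertex_share u)"
    by (intro sum_mono mult_right_mono weight vertex_share_nonneg)
  finally have loss: "(\<Sum>i\<le>D. jump_loss i) \<le> 3 - 2 * sqrt 2 + (\<Sum>u\<in>extra. vertex_share u)" by simp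
  have inj: "inj_on hub {..D}"
    by (rule inj_on_inverseI[where g = \<delta>]) (simp add: hub)
  have "real D + 1 - (\<Sum>i\<le>D. jump_loss i) = (\<Sum>i\<le>D. 1 - jump_loss i)"
    by (simp add: sum_subtractf)
  also have "\<dots> \<le> (\<Sum>i\<le>D. vertex_share (hub i))"
    by (rule sum_mono) (use hub_share[OF assms] in auto)
  also have "\<dots> = (\<Sum>u\<in>hub ` {..D}. vertex_share u)"
    using inj by (simp add: sum.reindex)
  finally have "real D + 1 - (\<Sum>i\<le>D. jump_loss i) + (\<Sum>u\<in>extra. vertex_share u)
      \<le> (\<Sum>u\<in>hub ` {..D}. vertex_share u) + (\<Sum>u\<in>extra. vertex_share u)" by simp
  also have "\<dots> = (\<Sum>u\<in>pverts G. vertex_share u)"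
    unfolding extra_def
    by (subst add.commute, rule sum.subset_diff[symmetric]) (auto simp: hub pair_finite_verts)
  finally show ?thesis using loss by (simp add: sum_vertex_share)
qed

text \<open>As many levels as vertices means one vertex per layer, so each parent is the unique
  vertex of the preceding layer and \<open>\<delta>\<close> numbers a path.\<close>

lemma isomorphic_path_graph:
  assumes "D + 1 = card (pverts G)"
  shows "isomorphic G (path_graph (card (pverts G)))"
proof -
  have "\<delta> ` pverts G = {..D}"
  proof
    show "{..D} \<subseteq> \<delta> ` pverts G" using layer_nonempty by (fastforce simp: layer_def)
  qed (use level_le in auto)
  then have img: "\<delta> ` pverts G = {..<card (pverts G)}" using assms by auto
  then have inj: "inj_on \<delta> (pverts G)"
    by (intro eq_card_imp_inj_on pair_finite_verts) simp
  have arc: "(u, v) \<in> parcs G" if uv: "u \<in> pverts G" "v \<in> pverts G" "\<delta> v = Suc (\<delta> u)" for u v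
  proof -
    have "\<delta> v > 0" using uv(3) by simp
    then obtain w where "(w, v) \<in> parcs G" "\<delta> v = Suc (\<delta> w)"
      using parent_ex[OF uv(2)] by blast
    then show ?thesis using inj uv in_arcsD1[of w v] by (auto dest: inj_onD)
  qed
  have "(u, v) \<in> parcs G \<longleftrightarrow> \<delta> v = Suc (\<delta> u) \<or> \<delta> u = Suc (\<delta> v)"
    if uv: "u \<in> pverts G" "v \<in> pverts G" for u v
  proof
    assume *: "(u, v) \<in> parcs G"
    then have "\<delta> u \<noteq> \<delta> v" using no_loops' uv inj by (auto dest: inj_onD)
    then show "\<delta> v = Suc (\<delta> u) \<or> \<delta> u = Suc (\<delta> v)"
      using level_Suc[OF *] level_Suc[OF arcs_symmetric[OF *]] by linarith
  qed (use uv arc arcs_symmetric in blast)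
  then show ?thesis
    using img inj isomorphic_path_graph_iff[OF pair_wf_digraph] by (auto simp: bij_betw_def)
qed

end

section \<open>Extremality of the path\<close>

context pair_graph
begin

lemma hops_eq_0:
  assumes "awalk x p v" "hops x v = 0"
  shows "v = x"
proof -
  obtain q where "awalk x q v" "length q = hops x v" using hops_witness[OF assms(1)] .
  then show ?thesis using assms(2) by (simp add: awalk_Nil_iff)
qed

text \<open>Appending an arc to a shortest walk bounds the change of level, and deleting the last
  arc of one produces a parent.\<close>

lemma layered_graph_hops:
  assumes "connected (with_proj G)" and "x \<in> pverts G" "y \<in> pverts G"
    and "\<And>v. v \<in> pverts G \<Longrightarrow> hops x v \<le> hops x y"
  shows "layered_graph G (hops x) (hops x y)"
proof unfold_locales
  have walk: "\<exists>q. awalk x q v \<and> length q = hops x v" if "v \<in> pverts G" for v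
    using connected_awalk[OF assms(1,2) that] hops_witness by metis
  show "hops x v \<le> Suc (hops x u)" if uv: "(u, v) \<in> parcs G" for u v
  proof -
    obtain q where "awalk x q u" "length q = hops x u" using walk[OF in_arcsD1[OF uv]] by blast
    then show ?thesis using hops_le[OF awalk_snoc[OF _ uv]] by fastforce
  qed
  show "\<exists>u. (u, v) \<in> parcs G \<and> hops x v = Suc (hops x u)"
    if v: "v \<in> pverts G" "hops x v > 0" for v
  proof -
    obtain q where q: "awalk x q v" "length q = hops x v" using walk v by blast
    then have "q \<noteq> []" using v by auto
    then obtain u where u: "awalk x (butlast q) u" "(u, v) \<in> parcs G"
      using awalk_butlast[OF q(1)] by blast
    obtain r where "awalk x r u" "length r = hops x u" using walk[OF in_arcsD1[OF u(2)]] by blast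
    then have "hops x v \<le> Suc (hops x u)" using hops_le[OF awalk_snoc[OF _ u(2)]] by fastforce
    then show ?thesis using hops_le[OF u(1)] q u(2) v by auto
  qed
qed (use assms in auto)

text \<open>The numbering \<open>h\<close> changes by one along each arc, so the vertices numbered 0
  and \<open>n - 1\<close> are at least \<open>n - 1\<close> apart.\<close>

lemma path_diameter_ge:
  assumes "connected (with_proj G)" and bij: "bij_betw h (pverts G) {..<n}" and "n \<ge> 1"
    and arcs: "\<And>u v. u \<in> pverts G \<Longrightarrow> v \<in> pverts G \<Longrightarrow>
      (u, v) \<in> parcs G \<longleftrightarrow> h v = Suc (h u) \<or> h u = Suc (h v)"
  shows "graph_diameter G \<ge> real n - 1"
proof -
  obtain x y where xy: "graph_diameter G = real (hops x y)"
    "\<And>u v. u \<in> pverts G \<Longrightarrow> v \<in> pverts G \<Longrightarrow> hops u v \<le> hops x y"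
    using graph_diameter_attained[OF assms(1)] by metis
  have "0 \<in> h ` pverts G" "n - 1 \<in> h ` pverts G"
    using bij \<open>n \<ge> 1\<close> by (auto simp: bij_betw_def)
  then obtain a b where ab: "a \<in> pverts G" "h a = 0" "b \<in> pverts G" "h b = n - 1" by auto
  obtain p where "awalk a p b" "length p = hops a b"
    using connected_awalk[OF assms(1) ab(1,3)] hops_witness by metis
  moreover have "h v \<le> Suc (h u)" if "(u, v) \<in> parcs G" for u v
    using arcs[of u v] that in_arcsD1 in_arcsD2 by fastforce
  ultimately have "n - 1 \<le> hops a b"
    using awalk_lipschitz[of h a p b] ab by simp
  then show ?thesis using xy(1) xy(2)[OF ab(1,3)] by simp
qed

text \<open>Equality will follow together with \<open>randic_index_ge\<close>, so lower bounds on
  degrees and a covering of the edge set are enough.\<close>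

lemma path_randic_index_le:
  assumes bij: "bij_betw h (pverts G) {..<n}" and "n \<ge> 3"
    and arcs: "\<And>u v. u \<in> pverts G \<Longrightarrow> v \<in> pverts G \<Longrightarrow>
      (u, v) \<in> parcs G \<longleftrightarrow> h v = Suc (h u) \<or> h u = Suc (h v)"
  shows "randic_index G \<le> sqrt 2 + (real n - 3) / 2"
proof -
  \<comment> \<open>There are \<open>N + 2\<close> edges: one at each end, and \<open>N\<close>
    whose endpoints both have degree at least 2.\<close>
  obtain N where n: "n = N + 3" using \<open>n \<ge> 3\<close> by (metis add.commute le_Suc_ex)
  define g where "g = the_inv_into (pverts G) h"
  have g: "g i \<in> pverts G" "h (g i) = i" if "i < n" for i
    using bij that by (auto simp: g_def bij_betw_def the_inv_into_into f_the_inv_into_f)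
  have gh: "g (h v) = v" if "v \<in> pverts G" for v
    using bij that by (auto simp: g_def bij_betw_def the_inv_into_f_f)
  have h_less: "h v < n" if "v \<in> pverts G" for v
    using bij that by (auto simp: bij_betw_def)
  have garc: "(g i, g (Suc i)) \<in> parcs G" "(g (Suc i), g i) \<in> parcs G" if "Suc i < n" for i
    using arcs g that by auto
  let ?w = "\<lambda>e. 1 / sqrt (\<Prod>u\<in>e. real (degree G u))"
  have deg1: "real (degree G (g i)) \<ge> 1" if "i < n" for i
  proof (cases "Suc i < n")
    case True
    then show ?thesis using degree_pos garc by fastforce
  next
    case False
    then obtain j where "i = Suc j" using that n by (cases i) auto
    then show ?thesis using degree_pos[OF garc(2)[of j]] that by simp
  qed
  have deg2: "real (degree G (g (Suc i))) \<ge> 2" if "Suc (Suc i) < n" for i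
  proof -
    have "{g i, g (Suc (Suc i))} \<subseteq> {v. (g (Suc i), v) \<in> parcs G}" using garc that by auto
    then have "card {g i, g (Suc (Suc i))} \<le> degree G (g (Suc i))"
      unfolding degree_eq_card using finite_neighbours by (intro card_mono)
    moreover have "g i \<noteq> g (Suc (Suc i))" using g that by (metis Suc_lessD n_not_Suc_n Suc_n_not_le_n le_SucI order_refl)
    ultimately show ?thesis by simp
  qed
  have w: "?w {g i, g (Suc i)} \<le> 1 / sqrt c"
    if "Suc i < n" "c \<le> real (degree G (g i)) * real (degree G (g (Suc i)))" "c > 0" for i c
  proof -
    have "g i \<noteq> g (Suc i)" using garc(1)[OF that(1)] no_loops' by blast
    moreover have "1 / sqrt (real (degree G (g i)) * real (degree G (g (Suc i)))) \<le> 1 / sqrt c"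
      using that by (intro divide_left_mono real_sqrt_le_mono mult_pos_pos) auto
    ultimately show ?thesis by simp
  qed
  have "edges G \<subseteq> (\<lambda>i. {g i, g (Suc i)}) ` {..<N + 2}"
  proof
    fix e assume "e \<in> edges G"
    then obtain u v where uv: "e = {u, v}" "(u, v) \<in> parcs G" by (auto simp: edges_def)
    then have V: "u \<in> pverts G" "v \<in> pverts G" by (auto dest: in_arcsD1 in_arcsD2)
    then consider "h v = Suc (h u)" | "h u = Suc (h v)" using arcs uv by blast
    then show "e \<in> (\<lambda>i. {g i, g (Suc i)}) ` {..<N + 2}"
    proof cases
      case 1
      then show ?thesis using V gh[of u] gh[of v] h_less[of v] uv n
        by (intro image_eqI[of _ _ "h u"]) auto
    next
      case 2
      then show ?thesis using V gh[of u] gh[of v] h_less[of u] uv n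
        by (intro image_eqI[of _ _ "h v"]) auto
    qed
  qed
  then have "randic_index G \<le> (\<Sum>e\<in>(\<lambda>i. {g i, g (Suc i)}) ` {..<N + 2}. ?w e)"
    unfolding randic_index_def by (intro sum_mono2) (auto simp: prod_nonneg)
  also have "\<dots> \<le> (\<Sum>i<N + 2. ?w {g i, g (Suc i)})"
    using sum_image_le[of "{..<N + 2}" ?w "\<lambda>i. {g i, g (Suc i)}"] by (simp add: prod_nonneg o_def)
  also have "\<dots> = ?w {g 0, g 1} + (\<Sum>i<N. ?w {g (Suc i), g (Suc (Suc i))}) + ?w {g (N + 1), g (N + 2)}"
  proof -
    have "(\<Sum>i<Suc (Suc N). f i) = f 0 + (\<Sum>i<N. f (Suc i)) + f (Suc N)" for f :: "nat \<Rightarrow> real"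
      unfolding sum.lessThan_Suc_shift[of f] by simp
    from this[of "\<lambda>i. ?w {g i, g (Suc i)}"] show ?thesis by simp
  qed
  also have "\<dots> \<le> 1 / sqrt 2 + (\<Sum>i<N. 1 / 2) + 1 / sqrt 2"
  proof (intro add_mono sum_mono)
    have "1 * 2 \<le> deg (g 0) * deg (g 1)"
      using deg1[of 0] deg2[of 0] n by (intro mult_mono) auto
    then show "?w {g 0, g 1} \<le> 1 / sqrt 2" using w[of 0 2] n by simp
    have "2 * 1 \<le> deg (g (N + 1)) * deg (g (N + 2))"
      using deg1[of "N + 2"] deg2[of N] n by (intro mult_mono) auto
    then show "?w {g (N + 1), g (N + 2)} \<le> 1 / sqrt 2" using w[of "N + 1" 2] n by simp
    fix i assume "i \<in> {..<N}"
    then have "2 * 2 \<le> deg (g (Suc i)) * deg (g (Suc (Suc i)))"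
      using deg2[of i] deg2[of "Suc i"] n by (intro mult_mono) auto
    then show "?w {g (Suc i), g (Suc (Suc i))} \<le> 1 / 2"
      using w[of "Suc i" 4] \<open>i \<in> {..<N}\<close> n by simp
  qed
  also have "\<dots> = sqrt 2 + (real n - 3) / 2" by (simp add: n field_simps)
  finally show ?thesis .
qed

end

text \<open>The lower bounds for difference and ratio obtained from \<open>randic_index_ge\<close>
  strictly decrease in the diameter, so equality forces diameter \<open>n - 1\<close> and hence a
  path.\<close>

theorem corollary1:
  fixes G :: "'a pair_pre_digraph" and n :: nat
  assumes "pair_graph G"
    and "Digraph_Component.connected (with_proj G)"
    and "card (pverts G) = n"
    and "n \<ge> 3"
  shows "randic_index G - graph_diameter G \<ge> sqrt 2 - (real n + 1) / 2
    \<and> randic_index G / graph_diameter G \<ge> (real n - 3 + 2 * sqrt 2) / (2 * real n - 2)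
    \<and> (randic_index G - graph_diameter G = sqrt 2 - (real n + 1) / 2
          \<longleftrightarrow> isomorphic G (path_graph n))
    \<and> (randic_index G / graph_diameter G = (real n - 3 + 2 * sqrt 2) / (2 * real n - 2)
          \<longleftrightarrow> isomorphic G (path_graph n))"
proof -
  interpret pair_graph G by fact
  obtain x y where x: "x \<in> pverts G" and y: "y \<in> pverts G"
    and diam: "graph_diameter G = real (hops x y)"
    and max: "\<And>u v. u \<in> pverts G \<Longrightarrow> v \<in> pverts G \<Longrightarrow> hops u v \<le> hops x y"
    using graph_diameter_attained[OF assms(2)] by metis
  define D where "D = hops x y"
  interpret layered_graph G "hops x" D
    unfolding D_def using layered_graph_hops[OF assms(2) x y] max x by blast
  let ?R = "randic_index G"
  have "D \<ge> 1"
  proof (rule ccontr)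
    assume "\<not> D \<ge> 1"
    then have "D = 0" by simp
    have "v = x" if v: "v \<in> pverts G" for v
    proof -
      obtain p where "awalk x p v" using connected_awalk[OF assms(2) x v] .
      then show ?thesis using hops_eq_0 level_le[OF v] \<open>D = 0\<close> by simp
    qed
    then have "pverts G \<subseteq> {x}" by blast
    then have "card (pverts G) \<le> card {x}" by (intro card_mono) auto
    then show False using assms(3,4) by simp
  qed
  have diam: "graph_diameter G = real D" using diam by (simp add: D_def)
  have "D + 1 \<le> n" using levels_le_card assms(3) by simp
  then have Dn: "real D \<le> real n - 1" by linarith
  have D0: "real D > 0" using \<open>D \<ge> 1\<close> by simp
  note lower = randic_index_ge[OF \<open>D \<ge> 1\<close>]
  have path: "isomorphic G (path_graph n)" if "real D \<ge> real n - 1"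
  proof -
    have "D + 1 = card (pverts G)" using that Dn assms(3) by linarith
    then show ?thesis using isomorphic_path_graph assms(3) by simp
  qed
  have iso: "?R = real D / 2 + sqrt 2 - 1 \<and> real D = real n - 1" if iso: "isomorphic G (path_graph n)"
  proof -
    obtain h where h: "bij_betw h (pverts G) {..<n}"
      "\<And>u v. u \<in> pverts G \<Longrightarrow> v \<in> pverts G \<Longrightarrow> (u, v) \<in> parcs G \<longleftrightarrow> h v = Suc (h u) \<or> h u = Suc (h v)"
      using iso isomorphic_path_graph_iff[OF pair_wf_digraph] by blast
    have D: "real D = real n - 1"
      using path_diameter_ge[OF assms(2) h(1) _ h(2)] Dn assms(4) diam by simp
    moreover have "?R \<le> sqrt 2 + (real n - 3) / 2"
      by (rule path_randic_index_le[OF h(1) assms(4) h(2)])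
    moreover from this have "?R \<le> real D / 2 + sqrt 2 - 1" using D by (simp add: field_simps)
    ultimately show ?thesis using lower D by (simp add: order_antisym)
  qed
  \<comment> \<open>The third term is the nonnegative surplus that vanishes exactly at diameter
    \<open>n - 1\<close>.\<close>
  have diff: "sqrt 2 - (real n + 1) / 2 + (real n - 1 - real D) / 2 \<le> ?R - real D"
    using lower by (simp add: field_simps)
  \<comment> \<open>Dividing the lower bound by \<open>D\<close> gives \<open>1 / 2 + c / D\<close>,
    strictly decreasing in \<open>D\<close> because \<open>c > 0\<close>.\<close>
  define c where "c = sqrt 2 - 1"
  have "c > 0" using sqrt2_bounds by (simp add: c_def)
  have ratio: "1 / 2 + c / real D \<le> ?R / real D"
    using divide_right_mono[OF lower, of "real D"] D0
    by (simp add: c_def add_divide_distrib diff_divide_distrib)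
  have rhs: "(real n - 3 + 2 * sqrt 2) / (2 * real n - 2) = 1 / 2 + c / (real n - 1)"
    using Dn D0 by (simp add: c_def divide_simps)
  have mono: "c / (real n - 1) \<le> c / real D"
    using Dn D0 \<open>c > 0\<close> by (intro divide_left_mono) auto
  have strict: "real D \<ge> real n - 1" if "c / real D \<le> c / (real n - 1)"
  proof (rule ccontr)
    assume "\<not> real D \<ge> real n - 1"
    then have "c / (real n - 1) < c / real D"
      using D0 \<open>c > 0\<close> by (intro divide_strict_left_mono mult_pos_pos) auto
    with that show False by simp
  qed
  show ?thesis
    unfolding diam rhs
  proof (intro conjI iffI)
    show "?R - real D \<ge> sqrt 2 - (real n + 1) / 2" using diff Dn by (simp add: field_simps)
    show "?R / real D \<ge> 1 / 2 + c / (real n - 1)" using ratio mono by linarith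
    show "isomorphic G (path_graph n)" if "?R - real D = sqrt 2 - (real n + 1) / 2"
      using that diff by (intro path) (simp add: field_simps)
    show "isomorphic G (path_graph n)" if "?R / real D = 1 / 2 + c / (real n - 1)"
      using that ratio by (intro path strict) linarith
    show "?R - real D = sqrt 2 - (real n + 1) / 2" if "isomorphic G (path_graph n)"
      using iso[OF that] by (simp add: field_simps)
    show "?R / real D = 1 / 2 + c / (real n - 1)" if "isomorphic G (path_graph n)"
    proof -
      have "?R = real D / 2 + c" using iso[OF that] by (simp add: c_def)
      then have "?R / real D = 1 / 2 + c / real D" using D0 by (simp add: add_divide_distrib)
      then show ?thesis using iso[OF that] by simp
    qed
  qed
qed

end
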